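(* For every connected graph $G$ and every non-trivial connected graph $H$, \[\gamma_{r2}(G\circ H)\ge 2\gamma(G).\]
   Context: All graphs are finite and simple; non-trivial means at least two vertices. A $2$-rainbow dominating function of a graph $X$ is a map $f\colon V(X)\to 2^{\{1,2\}}$ such that for every vertex $v$ with $f(v)=\emptyset$ we have $\bigcup_{u\in N(v)} f(u)=\{1,2\}$; its weight is $\sum_v |f(v)|$, and $\gamma_{r2}(X)$ is the minimum weight of such a function. The lexicographic product $G\circ H$ has vertex set $V(G)\times V(H)$, with $(g_1,h_1)$ adjacent to $(g_2,h_2)$ iff $g_1g_2\in E(G)$, or $g_1=g_2$ and $h_1h_2\in E(H)$. $\gamma(G)$ is the domination number of $G$. *)

theory Defs
  imports "Graph_Theory.Graph_Theory"
begin

text \<open>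
  Finite simple graphs are represented by the locale \<open>pair_graph\<close>, i.e. finite, loop-free,
  symmetric digraphs without parallel arcs: an edge uv is the pair of arcs (u, v), (v, u).
\<close>

definition neighbors :: "'a pair_pre_digraph \<Rightarrow> 'a \<Rightarrow> 'a set" where
  "neighbors X v = {u. (v, u) \<in> parcs X}"

definition dominating_set :: "'a pair_pre_digraph \<Rightarrow> 'a set \<Rightarrow> bool" where
  "dominating_set X D \<longleftrightarrow>
     D \<subseteq> pverts X \<and> (\<forall>v\<in>pverts X. v \<notin> D \<longrightarrow> (\<exists>u\<in>D. u \<in> neighbors X v))"

definition domination_number :: "'a pair_pre_digraph \<Rightarrow> nat" where
  "domination_number X = (LEAST k. \<exists>D. dominating_set X D \<and> card D = k)"

text \<open>
  Only the values of \<open>f\<close> on the vertex set matter in the two definitions below.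
\<close>

definition rainbow2_dominating :: "'a pair_pre_digraph \<Rightarrow> ('a \<Rightarrow> nat set) \<Rightarrow> bool" where
  "rainbow2_dominating X f \<longleftrightarrow>
     (\<forall>v\<in>pverts X. f v \<in> Pow {1, 2}) \<and>
     (\<forall>v\<in>pverts X. f v = {} \<longrightarrow> (\<Union>u\<in>neighbors X v. f u) = {1, 2})"

definition weight :: "'a pair_pre_digraph \<Rightarrow> ('a \<Rightarrow> nat set) \<Rightarrow> nat" where
  "weight X f = (\<Sum>v\<in>pverts X. card (f v))"

definition rainbow2_domination_number :: "'a pair_pre_digraph \<Rightarrow> nat" where
  "rainbow2_domination_number X = (LEAST k. \<exists>f. rainbow2_dominating X f \<and> weight X f = k)"

definition lex_product ::
    "'a pair_pre_digraph \<Rightarrow> 'b pair_pre_digraph \<Rightarrow> ('a \<times> 'b) pair_pre_digraph" where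
  "lex_product G H =
     \<lparr> pverts = pverts G \<times> pverts H,
       parcs = {((g1, h1), (g2, h2)) | g1 h1 g2 h2.
                  (g1, h1) \<in> pverts G \<times> pverts H \<and> (g2, h2) \<in> pverts G \<times> pverts H \<and>
                  ((g1, g2) \<in> parcs G \<or> g1 = g2 \<and> (h1, h2) \<in> parcs H)} \<rparr>"

text \<open>Both minima are taken over non-empty sets, hence are attained.\<close>

lemma domination_number_attained:
  "\<exists>D. dominating_set X D \<and> card D = domination_number X"
proof -
  have "dominating_set X (pverts X)"
    by (auto simp: dominating_set_def)
  then have "\<exists>k D. dominating_set X D \<and> card D = k" by blast
  then show ?thesis
    unfolding domination_number_def by (rule LeastI_ex)
qed

lemma rainbow2_domination_number_attained:
  "\<exists>f. rainbow2_dominating X f \<and> weight X f = rainbow2_domination_number X"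
proof -
  have "rainbow2_dominating X (\<lambda>_. {1})"
    by (auto simp: rainbow2_dominating_def)
  then have "\<exists>k f. rainbow2_dominating X f \<and> weight X f = k" by blast
  then show ?thesis
    unfolding rainbow2_domination_number_def by (rule LeastI_ex)
qed

lemma pair_graph_lex_product:
  assumes "pair_graph G" and "pair_graph H"
  shows "pair_graph (lex_product G H)"
proof -
  interpret G: pair_graph G by fact
  interpret H: pair_graph H by fact
  have sym: "(b, a) \<in> parcs G" if "(a, b) \<in> parcs G" for a b
    using G.sym_arcs that by (auto simp: symmetric_def dest: symD)
  have symH: "(b, a) \<in> parcs H" if "(a, b) \<in> parcs H" for a b
    using H.sym_arcs that by (auto simp: symmetric_def dest: symD)
  have fin: "finite (pverts (lex_product G H))"
    by (simp add: lex_product_def G.pair_finite_verts H.pair_finite_verts)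
  have sub: "parcs (lex_product G H) \<subseteq> pverts (lex_product G H) \<times> pverts (lex_product G H)"
    by (auto simp: lex_product_def)
  have "sym (parcs (lex_product G H))"
    by (rule symI) (auto simp: lex_product_def intro: sym symH)
  moreover have "finite (parcs (lex_product G H))"
    using finite_subset[OF sub] fin by blast
  moreover have "fst e \<noteq> snd e" if "e \<in> parcs (lex_product G H)" for e
    using that G.pair_no_loops H.pair_no_loops by (fastforce simp: lex_product_def)
  ultimately show ?thesis
    using fin sub by unfold_locales (auto simp: symmetric_def)
qed

end

theory Submission
  imports Defs
begin

text \<open>
  Let \<open>f\<close> be a 2-rainbow dominating function of the product, \<open>w g\<close> its weight on the
  copy of \<open>H\<close> over \<open>g\<close> and \<open>F g\<close> the set of colours used there. For each colour \<open>i\<close> let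
  \<open>D i\<close> consist of all \<open>g\<close> with \<open>i \<in> F g\<close> or \<open>w g \<ge> 2\<close>. If \<open>g \<notin> D i\<close>, then \<open>w g \<le> 1\<close>, so,
  \<open>H\<close> being non-trivial, some vertex over \<open>g\<close> has the empty label. It sees colour \<open>i\<close>,
  but not within its own copy, hence \<open>g\<close> has a neighbour in \<open>D i\<close>. So \<open>D 1\<close> and \<open>D 2\<close>
  dominate \<open>G\<close>, and each \<open>g\<close> lies in at most \<open>w g\<close> of them.
\<close>

lemma domination_number_le: "dominating_set X D \<Longrightarrow> domination_number X \<le> card D"
  unfolding domination_number_def by (rule Least_le) blast

lemma in_neighbors_lex_product:
  assumes "u \<in> neighbors (lex_product G H) (g, h)"
  shows "u \<in> pverts G \<times> pverts H"
    and "fst u \<in> neighbors G g \<or> fst u = g"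
  using assms by (auto simp: neighbors_def lex_product_def)

lemma rainbow2_dominating_lex_product_weight:
  fixes G :: "'a pair_pre_digraph" and H :: "'b pair_pre_digraph"
  assumes finG: "finite (pverts G)" and finH: "finite (pverts H)"
    and cardH: "card (pverts H) \<ge> 2"
    and f: "rainbow2_dominating (lex_product G H) f"
  shows "2 * domination_number G \<le> weight (lex_product G H) f"
proof -
  define w where "w g = (\<Sum>h\<in>pverts H. card (f (g, h)))" for g
  define F where "F g = (\<Union>h\<in>pverts H. f (g, h))" for g
  define D where "D i = {g \<in> pverts G. i \<in> F g \<or> w g \<ge> 2}" for i
  have sub: "f (g, h) \<subseteq> {1, 2}" if "g \<in> pverts G" "h \<in> pverts H" for g h
  proof -
    have "(g, h) \<in> pverts (lex_product G H)"
      using that by (simp add: lex_product_def)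
    then show ?thesis
      using f unfolding rainbow2_dominating_def by blast
  qed
  \<comment> \<open>\<open>card\<close> is 0 on infinite sets, so a non-empty label has positive
    size only once it is known to be finite.\<close>
  have fin: "finite (f (g, h))" if "g \<in> pverts G" "h \<in> pverts H" for g h
    using sub[OF that] finite_subset by blast
  have dom: "dominating_set G (D i)" if i: "i \<in> {1, 2}" for i
    unfolding dominating_set_def
  proof (intro conjI ballI impI)
    show "D i \<subseteq> pverts G" by (auto simp: D_def)
  next
    fix g assume g: "g \<in> pverts G" "g \<notin> D i"
    then have w: "w g < 2" and iF: "i \<notin> F g" by (auto simp: D_def)
    have "\<exists>h\<in>pverts H. f (g, h) = {}"
    proof (rule ccontr)
      \<comment> \<open>With all labels non-empty, the copy over \<open>g\<close> would weigh at
        least \<open>card (pverts H)\<close>, hence at least 2.\<close>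
      assume "\<not> ?thesis"
      then have "1 \<le> card (f (g, h))" if "h \<in> pverts H" for h
        using that fin[OF g(1) that] by (simp add: Suc_le_eq card_gt_0_iff)
      then have "(\<Sum>h\<in>pverts H. 1) \<le> w g"
        unfolding w_def by (intro sum_mono) auto
      then show False using w cardH by simp
    qed
    then obtain h where h: "h \<in> pverts H" "f (g, h) = {}" by blast
    have "(g, h) \<in> pverts (lex_product G H)"
      using g(1) h(1) by (simp add: lex_product_def)
    then have "(\<Union>u\<in>neighbors (lex_product G H) (g, h). f u) = {1, 2}"
      using f h(2) unfolding rainbow2_dominating_def by blast
    then obtain u where u: "u \<in> neighbors (lex_product G H) (g, h)" "i \<in> f u"
      using i by blast
    have uV: "fst u \<in> pverts G" "snd u \<in> pverts H"
      using in_neighbors_lex_product(1)[OF u(1)] by auto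
    have iu: "i \<in> F (fst u)"
      using u(2) uV by (auto simp: F_def intro!: bexI[of _ "snd u"])
    \<comment> \<open>If \<open>u\<close> lay over \<open>g\<close>, its colour \<open>i\<close>
      would be in \<open>F g\<close>. So the adjacency to \<open>u\<close> comes from an edge of
      \<open>G\<close>.\<close>
    then have "fst u \<noteq> g" using iF by auto
    then have "fst u \<in> neighbors G g"
      using in_neighbors_lex_product(2)[OF u(1)] by auto
    then show "\<exists>u\<in>D i. u \<in> neighbors G g"
      using iu uV by (auto simp: D_def)
  qed
  have card_D: "card (D i) = (\<Sum>g\<in>pverts G. of_bool (g \<in> D i))" for i
  proof -
    have "{g \<in> pverts G. g \<in> D i} = D i" by (auto simp: D_def)
    then show ?thesis using sum.inter_filter[OF finG, of "\<lambda>_. 1::nat" "\<lambda>g. g \<in> D i"]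
      by (simp add: of_bool_def)
  qed
  \<comment> \<open>Two indicators never exceed 2. If \<open>w g < 2\<close>, only its colours put
    \<open>g\<close> into \<open>D 1\<close> or \<open>D 2\<close>, and their number is at most the
    sum of the label sizes.\<close>
  have count: "of_bool (g \<in> D 1) + of_bool (g \<in> D 2) \<le> w g" if g: "g \<in> pverts G" for g
  proof (cases "w g \<ge> 2")
    case True
    then show ?thesis by simp
  next
    case False
    have "F g \<subseteq> {1, 2}" using sub[OF g] by (auto simp: F_def)
    then consider "F g = {}" | "F g = {1}" | "F g = {2}" | "F g = {1, 2}" by blast
    then have "of_bool (1 \<in> F g) + of_bool (2 \<in> F g) = card (F g)"
      by cases simp_all
    also have "\<dots> \<le> w g"
      unfolding F_def w_def by (rule card_UN_le[OF finH])
    finally show ?thesis using False g by (simp add: D_def)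
  qed
  have "2 * domination_number G \<le> card (D 1) + card (D 2)"
    using domination_number_le[OF dom[of 1]] domination_number_le[OF dom[of 2]] by simp
  also have "\<dots> = (\<Sum>g\<in>pverts G. of_bool (g \<in> D 1) + of_bool (g \<in> D 2))"
    by (simp only: card_D sum.distrib)
  also have "\<dots> \<le> (\<Sum>g\<in>pverts G. w g)"
    by (rule sum_mono) (rule count)
  also have "\<dots> = weight (lex_product G H) f"
    by (simp add: weight_def w_def lex_product_def sum.cartesian_product)
  finally show ?thesis .
qed

theorem theorem8:
  fixes G :: "'a pair_pre_digraph" and H :: "'b pair_pre_digraph"
  assumes "pair_graph G" and "connected (with_proj G)"
    and "pair_graph H" and "connected (with_proj H)" and "card (pverts H) \<ge> 2"
  shows "rainbow2_domination_number (lex_product G H) \<ge> 2 * domination_number G"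
proof -
  interpret G: pair_graph G by fact
  interpret H: pair_graph H by fact
  obtain f where f: "rainbow2_dominating (lex_product G H) f"
    and "weight (lex_product G H) f = rainbow2_domination_number (lex_product G H)"
    using rainbow2_domination_number_attained by blast
  then show ?thesis
    using rainbow2_dominating_lex_product_weight[OF G.pair_finite_verts H.pair_finite_verts
        assms(5) f]
    by simp
qed

end
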